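(* Let $A=v_1\wedge\cdots\wedge v_p$ and $B=w_1\wedge\cdots\wedge w_q$ with $v_i,w_j\in X$, let $\mathbf A=(\langle v_i,w_j\rangle)$ be the associated $p\times q$ matrix, let $(u_1,\dots,u_n)$ be an arbitrary basis of $X$, and let $\mathbf W$ be the $n\times q$ matrix whose $j$-th column is formed by the coordinates of $w_j$ in this basis. If $p\le q$ then $$A\lrcorner B=\sum_{\mathbf j\in\mathcal I^q_p}\epsilon_{\mathbf j\mathbf j'}\det(\mathbf A_{\mathbf j})\,w_{\mathbf j'}=\sum_{\mathbf i\in\mathcal I^n_{q-p}}\det\begin{pmatrix}\mathbf A\\ \mathbf W_{\mathbf i}\end{pmatrix}u_{\mathbf i},$$ where $\mathbf A_{\mathbf j}$ is the submatrix of $\mathbf A$ formed by the columns with indices in $\mathbf j$, and $\mathbf W_{\mathbf i}$ is the submatrix of $\mathbf W$ formed by the rows with indices in $\mathbf i$.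
   Context: $X$ is an $n$-dimensional Euclidean (real) or Hermitian (complex) vector space with inner product $\langle\cdot,\cdot\rangle$, conjugate-linear in the left entry in the complex case. $\bigwedge X$ is its exterior algebra, with inner product given by $\langle v_1\wedge\cdots\wedge v_p,w_1\wedge\cdots\wedge w_p\rangle=\det(\langle v_i,w_j\rangle)$, with distinct $\bigwedge^pX$'s orthogonal, $\langle\kappa,\lambda\rangle=\bar\kappa\lambda$ for scalars, extended (sesqui)linearly. The left contraction $M\lrcorner N$ of $M,N\in\bigwedge X$ is the unique element with $\langle L,M\lrcorner N\rangle=\langle M\wedge L,N\rangle$ for all $L\in\bigwedge X$. Multi-indices: $\mathcal I^q_p$ is the set of strictly increasing $p$-tuples with entries in $\{1,\dots,q\}$, with $\mathcal I^q_0=\{\emptyset\}$. For $\mathbf j\in\mathcal I^q_p$, $\mathbf j'$ is the increasing tuple of elements of $\{1,\dots,q\}$ not in $\mathbf j$, and $\epsilon_{\mathbf j\mathbf j'}$ is the sign of the permutation that puts the concatenation $\mathbf j\mathbf j'$ in increasing order. For a tuple $\mathbf r=(r_1,\dots,r_k)$, $w_{\mathbf r}=w_{r_1}\wedge\cdots\wedge w_{r_k}$, $w_\emptyset=1$, and similarly for $u_{\mathbf i}$. *)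

theory Defs
  imports
    "HOL-Analysis.Inner_Product"
    "HOL-Library.Poly_Mapping"
    "HOL-Combinatorics.Permutations"
    "Jordan_Normal_Form.Determinant"
begin

text \<open>
  Scalar fields with a conjugation. The norm axiom makes every element a root of a real
  quadratic polynomial, so up to isomorphism the only models are \<open>\<real>\<close> with the identity
  and \<open>\<complex>\<close> with complex conjugation. The class lets one statement cover the Euclidean and the
  Hermitian case.
\<close>

class real_or_complex = real_normed_field +
  fixes conj :: "'a \<Rightarrow> 'a"
  assumes conj_add: "conj (x + y) = conj x + conj y"
    and conj_mult: "conj (x * y) = conj x * conj y"
    and conj_scaleR: "conj (r *\<^sub>R x) = r *\<^sub>R conj x"
    and conj_conj: "conj (conj x) = x"
    and conj_mult_self: "conj x * x = (norm x)\<^sup>2 *\<^sub>R 1"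

instantiation real :: real_or_complex
begin
definition conj_real :: "real \<Rightarrow> real" where "conj_real x = x"
instance by standard (simp_all add: conj_real_def power2_eq_square)
end

instantiation complex :: real_or_complex
begin
definition conj_complex :: "complex \<Rightarrow> complex" where "conj_complex = cnj"
instance
proof
  fix x :: complex
  show "conj x * x = (norm x)\<^sup>2 *\<^sub>R 1"
    by (simp only: conj_complex_def scaleR_conv_of_real complex_norm_square) (simp add: mult.commute)
qed (simp_all add: conj_complex_def)
end

locale inner_product_space = vector_space scale
  for scale :: "'k::real_or_complex \<Rightarrow> 'a::ab_group_add \<Rightarrow> 'a" +
  fixes ip :: "'a \<Rightarrow> 'a \<Rightarrow> 'k"
  assumes ip_add_right: "ip x (y + z) = ip x y + ip x z"
    and ip_scale_right: "ip x (scale c y) = c * ip x y"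
    and ip_commute: "ip y x = conj (ip x y)"
    and ip_pos: "x \<noteq> 0 \<Longrightarrow> \<exists>r>0. ip x x = of_real r"

lemma inner_product_space_real_inner:
  "inner_product_space (scaleR :: real \<Rightarrow> 'a::real_inner \<Rightarrow> 'a) inner"
proof
  fix x :: 'a
  assume "x \<noteq> 0"
  then show "\<exists>r>0. inner x x = of_real r"
    by (intro exI[of _ "inner x x"]) simp
qed (simp_all add: inner_add_right inner_commute conj_real_def scaleR_add_right scaleR_add_left)

lemma inner_product_space_complex:
  "inner_product_space ((*) :: complex \<Rightarrow> complex \<Rightarrow> complex) (\<lambda>x y. cnj x * y)"
proof
  fix x :: complex
  assume "x \<noteq> 0"
  then show "\<exists>r>0. cnj x * x = of_real r"
    by (intro exI[of _ "(norm x)\<^sup>2"]) (simp only: complex_norm_square, simp add: mult.commute)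
qed (simp_all add: algebra_simps conj_complex_def)

locale finite_inner_product_space = inner_product_space scale ip
  for scale :: "'k::real_or_complex \<Rightarrow> 'a::ab_group_add \<Rightarrow> 'a"
    and ip :: "'a \<Rightarrow> 'a \<Rightarrow> 'k" +
  fixes n :: nat
  assumes finitely_spanned: "\<exists>S. finite S \<and> span S = UNIV"
    and dim_UNIV: "dim UNIV = n"

text \<open>
  The exterior algebra is the tensor algebra modulo the ideal generated by all
  \<open>v \<otimes> v\<close>. The tensor algebra is in turn the free algebra on the set of vectors (finitely
  supported functions on words) modulo multilinearity, so the exterior algebra is the free
  algebra modulo the following two-sided ideal. Closure under negation and under multiplication
  by words and scalars comes from the parameters \<open>xs\<close>, \<open>ys\<close> and \<open>c\<close>.
\<close>

inductive_set exterior_ideal :: "('k::field \<Rightarrow> 'a::ab_group_add \<Rightarrow> 'a) \<Rightarrow> ('a list \<Rightarrow>\<^sub>0 'k) set"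
  for scale :: "'k \<Rightarrow> 'a \<Rightarrow> 'a"
  where
    zero: "0 \<in> exterior_ideal scale"
  | plus: "x \<in> exterior_ideal scale \<Longrightarrow> y \<in> exterior_ideal scale \<Longrightarrow> x + y \<in> exterior_ideal scale"
  | additive: "Poly_Mapping.single (xs @ (v + w) # ys) c
      - Poly_Mapping.single (xs @ v # ys) c - Poly_Mapping.single (xs @ w # ys) c
      \<in> exterior_ideal scale"
  | homogeneous: "Poly_Mapping.single (xs @ scale a v # ys) c
      - Poly_Mapping.single (xs @ v # ys) (c * a) \<in> exterior_ideal scale"
  | square: "Poly_Mapping.single (xs @ v # v # ys) c \<in> exterior_ideal scale"

text \<open>The product of the ring type \<open>'e\<close> plays the role of the wedge product.\<close>

definition wedge_list :: "('a \<Rightarrow> 'e::ring_1) \<Rightarrow> 'a list \<Rightarrow> 'e"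
  where "wedge_list \<iota> vs = prod_list (map \<iota> vs)"

definition free_algebra_map ::
  "('k::field \<Rightarrow> 'e::ring_1 \<Rightarrow> 'e) \<Rightarrow> ('a \<Rightarrow> 'e) \<Rightarrow> ('a list \<Rightarrow>\<^sub>0 'k) \<Rightarrow> 'e"
  where "free_algebra_map scaleE \<iota> x =
    (\<Sum>vs\<in>Poly_Mapping.keys x. scaleE (Poly_Mapping.lookup x vs) (wedge_list \<iota> vs))"

text \<open>
  \<open>'e\<close> with \<open>\<iota>\<close> is an exterior algebra of \<open>'a\<close> if the algebra homomorphism from the free algebra
  that extends \<open>\<iota>\<close> induces an isomorphism from the quotient above; linearity of \<open>\<iota>\<close> and
  \<open>\<iota> v * \<iota> v = 0\<close> are part of the kernel condition.
\<close>

locale exterior_algebra = X: vector_space scale + E: vector_space scaleE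
  for scale :: "'k::field \<Rightarrow> 'a::ab_group_add \<Rightarrow> 'a"
    and scaleE :: "'k \<Rightarrow> 'e::ring_1 \<Rightarrow> 'e" +
  fixes \<iota> :: "'a \<Rightarrow> 'e"
  assumes scaleE_mult_left: "scaleE c x * y = scaleE c (x * y)"
    and scaleE_mult_right: "x * scaleE c y = scaleE c (x * y)"
    and surj_free_algebra_map: "surj (free_algebra_map scaleE \<iota>)"
    and kernel_free_algebra_map:
      "{x. free_algebra_map scaleE \<iota> x = 0} = exterior_ideal scale"

definition gram_matrix :: "('a \<Rightarrow> 'a \<Rightarrow> 'k) \<Rightarrow> 'a list \<Rightarrow> 'a list \<Rightarrow> 'k mat"
  where "gram_matrix ip vs ws = mat (length vs) (length ws) (\<lambda>(i, j). ip (vs ! i) (ws ! j))"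

text \<open>
  The two conditions below determine \<open>ipE\<close>, since products of vectors span. For empty lists the
  determinant is 1, which gives \<open>ipE \<kappa> \<lambda> = conj \<kappa> * \<lambda>\<close> on scalars.
\<close>

locale inner_exterior_algebra =
  X: finite_inner_product_space scale ip n + exterior_algebra scale scaleE \<iota> +
  E: inner_product_space scaleE ipE
  for n :: nat
    and scale :: "'k::real_or_complex \<Rightarrow> 'a::ab_group_add \<Rightarrow> 'a"
    and ip :: "'a \<Rightarrow> 'a \<Rightarrow> 'k"
    and scaleE :: "'k \<Rightarrow> 'e::ring_1 \<Rightarrow> 'e"
    and \<iota> :: "'a \<Rightarrow> 'e"
    and ipE :: "'e \<Rightarrow> 'e \<Rightarrow> 'k" +
  assumes ipE_wedge_list: "length vs = length ws \<Longrightarrow>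
      ipE (wedge_list \<iota> vs) (wedge_list \<iota> ws) = det (gram_matrix ip vs ws)"
    and ipE_orthogonal: "length vs \<noteq> length ws \<Longrightarrow>
      ipE (wedge_list \<iota> vs) (wedge_list \<iota> ws) = 0"

definition left_contraction :: "('e::ring_1 \<Rightarrow> 'e \<Rightarrow> 'k) \<Rightarrow> 'e \<Rightarrow> 'e \<Rightarrow> 'e"
  where "left_contraction ipE M N = (THE C. \<forall>L. ipE L C = ipE (M * L) N)"

text \<open>Indices start at 0, as for lists and matrices; the sign below is not affected by the shift.\<close>

definition multi_indices :: "nat \<Rightarrow> nat \<Rightarrow> nat list set"
  where "multi_indices q p = {js. sorted_wrt (<) js \<and> length js = p \<and> set js \<subseteq> {..<q}}"

definition complement_index :: "nat \<Rightarrow> nat list \<Rightarrow> nat list"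
  where "complement_index q js = sorted_list_of_set ({..<q} - set js)"

definition ordering_sign :: "nat list \<Rightarrow> int"
  where "ordering_sign l =
    sign (THE \<sigma>. \<sigma> permutes {..<length l} \<and> sorted_wrt (<) (permute_list \<sigma> l))"

definition select :: "'a list \<Rightarrow> nat list \<Rightarrow> 'a list"
  where "select xs js = map (\<lambda>j. xs ! j) js"

definition column_submatrix :: "'k mat \<Rightarrow> nat list \<Rightarrow> 'k mat"
  where "column_submatrix A js = mat_of_cols (dim_row A) (map (col A) js)"

definition row_submatrix :: "'k mat \<Rightarrow> nat list \<Rightarrow> 'k mat"
  where "row_submatrix A is = mat_of_rows (dim_col A) (map (row A) is)"

definition is_basis :: "('k::field \<Rightarrow> 'a::ab_group_add \<Rightarrow> 'a) \<Rightarrow> 'a list \<Rightarrow> bool"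
  where "is_basis scale us \<longleftrightarrow> distinct us \<and> \<not> module.dependent scale (set us)
    \<and> module.span scale (set us) = UNIV"

definition coordinate_matrix ::
  "('k::field \<Rightarrow> 'a::ab_group_add \<Rightarrow> 'a) \<Rightarrow> 'a list \<Rightarrow> 'a list \<Rightarrow> 'k mat"
  where "coordinate_matrix scale us ws = mat (length us) (length ws)
    (\<lambda>(i, j). module.representation scale (set us) (ws ! j) (us ! i))"

end

theory Submission
  imports Defs
begin

text \<open>
  The inner product of the exterior algebra is definite, and products of vectors span, so an
  element is determined by its inner products with all \<open>x\<^sub>1 \<and> \<dots> \<and> x\<^sub>r\<close>. For the contraction of
  \<open>B = w\<^sub>1 \<and> \<dots> \<and> w\<^sub>q\<close> by \<open>A = v\<^sub>1 \<and> \<dots> \<and> v\<^sub>p\<close> this inner product is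
  \<open>\<langle>v\<^sub>1 \<and> \<dots> \<and> v\<^sub>p \<and> x\<^sub>1 \<and> \<dots> \<and> x\<^sub>r, B\<rangle>\<close>. It vanishes unless \<open>p + r = q\<close>, and then it is the determinant
  whose first \<open>p\<close> rows are \<open>\<langle>v\<^sub>i, w\<^sub>j\<rangle>\<close> and whose last \<open>q - p\<close> rows are \<open>\<langle>x\<^sub>i, w\<^sub>j\<rangle>\<close>. Both formulas for
  the contraction are thereby statements about determinants
  (lemma \<open>left_contraction_wedge_eqI\<close>), and no computation with wedge products remains.

  The first formula is the Laplace expansion of that determinant along its first \<open>p\<close> rows
  (\<open>laplace_expansion_rows\<close>). For the second, the lower block factors as \<open>G W\<close>, where \<open>G\<close> has the
  entries \<open>\<langle>x\<^sub>i, u\<^sub>k\<rangle>\<close> and \<open>W\<close> holds the coordinates of the \<open>w\<^sub>j\<close>. After a Laplace expansion, each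
  complementary minor of \<open>G W\<close> is a sum of products of minors of \<open>G\<close> and of \<open>W\<close>, by
  \<open>cauchy_binet\<close>. Collecting the terms that share a minor of \<open>G\<close>, a Laplace expansion in the other
  direction assembles the determinant of \<open>\<langle>v\<^sub>i, w\<^sub>j\<rangle>\<close> stacked on the chosen rows of \<open>W\<close>
  (\<open>det_append_mult_rows\<close>).
\<close>

section \<open>Increasing multi-indices\<close>

lemma nth_less_if_set_subset:
  assumes "set js \<subseteq> {..<q}" "i < length js"
  shows "js ! i < q"
  using assms by (meson lessThan_iff nth_mem subsetD)

lemma finite_multi_indices: "finite (multi_indices q p)"
proof (rule finite_subset)
  show "multi_indices q p \<subseteq> {js. set js \<subseteq> {..<q} \<and> length js = p}"
    by (auto simp: multi_indices_def)
qed (simp add: finite_lists_length_eq)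

lemma multi_indices_eqI:
  assumes "is \<in> multi_indices q p" "js \<in> multi_indices q p" "set is = set js"
  shows "is = js"
  using assms strict_sorted_equal[of js "is"] by (simp add: multi_indices_def)

lemma multi_indices_distinct:
  assumes "js \<in> multi_indices q p"
  shows "distinct js"
  using assms by (simp add: multi_indices_def strict_sorted_iff)

lemma multi_indices_nth_less:
  assumes "js \<in> multi_indices q p" "i < p"
  shows "js ! i < q"
  using assms by (auto simp: multi_indices_def intro: nth_less_if_set_subset)

lemma sorted_list_of_set_multi_indices:
  assumes "S \<subseteq> {..<q}"
  shows "sorted_list_of_set S \<in> multi_indices q (card S)"
  using assms finite_subset[OF assms] by (simp add: multi_indices_def)

lemma complement_index_multi_indices:
  assumes "js \<in> multi_indices q p"
  shows "complement_index q js \<in> multi_indices q (q - p)"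
proof -
  have "card ({..<q} - set js) = q - p"
    using assms multi_indices_distinct[OF assms]
    by (subst card_Diff_subset) (auto simp: multi_indices_def distinct_card)
  then show ?thesis
    using sorted_list_of_set_multi_indices[of "{..<q} - set js" q]
    by (simp add: complement_index_def)
qed

lemma set_complement_index: "set (complement_index q js) = {..<q} - set js"
  by (simp add: complement_index_def)

text \<open>
  A list that enumerates \<open>0, \<dots>, length l - 1\<close> in some order becomes a permutation only when
  completed by the identity beyond its length, since \<open>permutes\<close> constrains a total function.
\<close>

definition extend_by_id :: "nat list \<Rightarrow> nat \<Rightarrow> nat"
  where "extend_by_id l i = (if i < length l then l ! i else i)"

lemma extend_by_id_permutes:
  assumes "distinct l" "set l = {..<length l}"
  shows "extend_by_id l permutes {..<length l}"
proof (rule bij_imp_permutes)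
  have "bij_betw (\<lambda>i. l ! i) {..<length l} (set l)"
    using assms by (intro bij_betw_nth) auto
  then show "bij_betw (extend_by_id l) {..<length l} {..<length l}"
    using assms by (subst bij_betw_cong[where g = "(!) l"]) (auto simp: extend_by_id_def)
qed (simp add: extend_by_id_def)

text \<open>
  Sorting an arrangement \<open>l\<close> of \<open>0, \<dots>, length l - 1\<close> composes \<open>l\<close>, read as a permutation, with
  its inverse, and inversion preserves signs.
\<close>

lemma ordering_sign_eq_sign:
  assumes l: "distinct l" "set l = {..<length l}"
  shows "ordering_sign l = sign (extend_by_id l)"
proof -
  let ?\<tau> = "extend_by_id l" and ?q = "length l"
  let ?inv = "Hilbert_Choice.inv ?\<tau>"
  note \<tau> = extend_by_id_permutes[OF l]
  have nth: "l ! i = ?\<tau> i" if "i < ?q" for i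
    using that by (simp add: extend_by_id_def)
  have inv_less: "?inv i < ?q" if "i < ?q" for i
    using that permutes_in_image[OF permutes_inv[OF \<tau>], of i] by simp
  have "(THE \<sigma>. \<sigma> permutes {..<?q} \<and> sorted_wrt (<) (permute_list \<sigma> l)) = ?inv"
  proof (rule the_equality)
    have "permute_list ?inv l = [0..<?q]"
      using inv_less by (intro nth_equalityI)
        (simp_all add: permute_list_nth[OF permutes_inv[OF \<tau>]] nth permutes_inverses[OF \<tau>])
    then show "?inv permutes {..<?q} \<and> sorted_wrt (<) (permute_list ?inv l)"
      by (simp add: permutes_inv[OF \<tau>])
  next
    fix \<sigma>
    assume \<sigma>: "\<sigma> permutes {..<?q} \<and> sorted_wrt (<) (permute_list \<sigma> l)"
    then have eq: "permute_list \<sigma> l = [0..<?q]"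
      using l by (intro strict_sorted_equal) (auto simp: atLeast0LessThan)
    show "\<sigma> = ?inv"
    proof
      fix i
      show "\<sigma> i = ?inv i"
      proof (cases "i < ?q")
        case True
        then have "l ! \<sigma> i = i"
          using permute_list_nth[of \<sigma> l i] \<sigma> eq by simp
        moreover have "\<sigma> i < ?q"
          using \<sigma> True permutes_in_image[of \<sigma> "{..<?q}" i] by simp
        ultimately show ?thesis
          using nth permutes_inv_eq[OF \<tau>] by metis
      next
        case False
        then show ?thesis
          using \<sigma> permutes_inv[OF \<tau>] by (simp add: permutes_not_in[of _ "{..<?q}"])
      qed
    qed
  qed
  moreover have "permutation ?\<tau>"
    using \<tau> permutation_permutes by blast
  ultimately show ?thesis
    by (simp add: ordering_sign_def sign_inverse)
qed

section \<open>Laplace expansion along several rows\<close>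

lemma column_submatrix_carrier [simp]:
  "A \<in> carrier_mat a b \<Longrightarrow> column_submatrix A js \<in> carrier_mat a (length js)"
  by (auto simp: column_submatrix_def)

lemma column_submatrix_index:
  assumes "A \<in> carrier_mat a b" "i < a" "j < length js" "js ! j < b"
  shows "column_submatrix A js $$ (i, j) = A $$ (i, js ! j)"
  using assms by (simp add: column_submatrix_def mat_of_cols_index)

lemma row_submatrix_carrier [simp]:
  "A \<in> carrier_mat a b \<Longrightarrow> row_submatrix A is \<in> carrier_mat (length is) b"
  by (auto simp: row_submatrix_def)

lemma row_submatrix_index:
  assumes "A \<in> carrier_mat a b" "i < length is" "j < b" "is ! i < a"
  shows "row_submatrix A is $$ (i, j) = A $$ (is ! i, j)"
  using assms by (simp add: row_submatrix_def mat_of_rows_index)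

lemma append_rows_index:
  assumes "A \<in> carrier_mat a c" "B \<in> carrier_mat b c" "i < a + b" "j < c"
  shows "(A @\<^sub>r B) $$ (i, j) = (if i < a then A $$ (i, j) else B $$ (i - a, j))"
  using assms by (auto simp: append_rows_def)

lemma det_permute_columns:
  assumes A: "A \<in> carrier_mat n n" and \<sigma>: "\<sigma> permutes {0..<n}"
  shows "det (mat n n (\<lambda>(i, j). A $$ (i, \<sigma> j))) = signof \<sigma> * det A"
proof -
  let ?B = "mat n n (\<lambda>(i, j). A $$ (i, \<sigma> j))"
  have less: "\<sigma> j < n" if "j < n" for j
    using that permutes_in_image[OF \<sigma>, of j] by simp
  have "det ?B = det (?B\<^sup>T)"
    by (rule det_transpose[symmetric]) auto
  also have "?B\<^sup>T = mat n n (\<lambda>(i, j). A\<^sup>T $$ (\<sigma> i, j))"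
    using A less by (intro eq_matI) auto
  also have "det \<dots> = signof \<sigma> * det (A\<^sup>T)"
    using A \<sigma> by (intro det_permute_rows) auto
  also have "det (A\<^sup>T) = det A"
    by (rule det_transpose[OF A])
  finally show ?thesis .
qed

text \<open>
  If \<open>M\<close> is square and \<open>J\<close> has \<open>p\<close> elements, the zeros remove from the Leibniz formula for \<open>M\<close>
  all terms except those of the permutations that map the first \<open>p\<close> row indices onto \<open>J\<close>.
\<close>

definition restrict_blocks :: "nat \<Rightarrow> nat set \<Rightarrow> 'k::zero mat \<Rightarrow> 'k mat"
  where "restrict_blocks p J M = mat (dim_row M) (dim_col M)
    (\<lambda>(i, j). if i < p \<longleftrightarrow> j \<in> J then M $$ (i, j) else 0)"

lemma restrict_blocks_carrier [simp]:
  "M \<in> carrier_mat a b \<Longrightarrow> restrict_blocks p J M \<in> carrier_mat a b"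
  by (auto simp: restrict_blocks_def)

text \<open>
  Moving the columns in \<open>js\<close> to the front, at the cost of the sign of this rearrangement, makes
  the matrix block diagonal.
\<close>

lemma det_restrict_blocks:
  fixes A B :: "'k::idom mat"
  assumes A: "A \<in> carrier_mat p q" and B: "B \<in> carrier_mat (q - p) q"
    and pq: "p \<le> q" and js: "js \<in> multi_indices q p"
  shows "det (restrict_blocks p (set js) (A @\<^sub>r B)) =
    of_int (ordering_sign (js @ complement_index q js)) * det (column_submatrix A js)
      * det (column_submatrix B (complement_index q js))"
proof -
  let ?c = "complement_index q js" and ?N = "restrict_blocks p (set js) (A @\<^sub>r B)"
  note c = complement_index_multi_indices[OF js]
  have len: "length js = p" "length ?c = q - p"
    using js c by (simp_all add: multi_indices_def)
  have AB: "A @\<^sub>r B \<in> carrier_mat q q"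
    using carrier_append_rows[OF A B] pq by simp
  define l where "l = js @ ?c"
  have l: "distinct l" "set l = {..<length l}" "length l = q"
    using js c multi_indices_distinct[OF js] multi_indices_distinct[OF c] len pq
    by (auto simp: l_def set_complement_index multi_indices_def)
  define \<tau> where "\<tau> = extend_by_id l"
  have \<tau>: "\<tau> permutes {0..<q}"
    using extend_by_id_permutes[OF l(1,2)] l(3) by (simp add: \<tau>_def atLeast0LessThan)
  have \<tau>_nth: "\<tau> j = (if j < p then js ! j else ?c ! (j - p))" if "j < q" for j
    using that l(3) len by (simp add: \<tau>_def extend_by_id_def l_def nth_append)
  have \<tau>_less: "\<tau> j < q" if "j < q" for j
    using that permutes_in_image[OF \<tau>, of j] by simp
  have \<tau>_mem: "\<tau> j \<in> set js \<longleftrightarrow> j < p" if "j < q" for j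
  proof (cases "j < p")
    case False
    then have "?c ! (j - p) \<in> set ?c"
      using that len by (intro nth_mem) simp
    then show ?thesis
      using False by (simp add: \<tau>_nth[OF that] set_complement_index)
  qed (use len in \<open>simp add: \<tau>_nth[OF that]\<close>)
  have "signof \<tau> * det ?N = det (mat q q (\<lambda>(i, j). ?N $$ (i, \<tau> j)))"
    using AB \<tau> by (intro det_permute_columns[symmetric]) auto
  also have "mat q q (\<lambda>(i, j). ?N $$ (i, \<tau> j)) =
      four_block_mat (column_submatrix A js) (0\<^sub>m p (q - p)) (0\<^sub>m (q - p) p) (column_submatrix B ?c)"
    (is "?L = ?R")
  proof (rule eq_matI)
    have dims: "dim_row ?R = q" "dim_col ?R = q"
      using A B len pq by (auto simp: column_submatrix_def)
    then show "dim_row ?L = dim_row ?R" "dim_col ?L = dim_col ?R"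
      by simp_all
    fix i j
    assume "i < dim_row ?R" "j < dim_col ?R"
    then have ij: "i < q" "j < q"
      using dims by simp_all
    have "?L $$ (i, j) = (if i < p \<longleftrightarrow> j < p then (A @\<^sub>r B) $$ (i, \<tau> j) else 0)"
      using ij AB \<tau>_less[OF ij(2)] \<tau>_mem[OF ij(2)] by (auto simp: restrict_blocks_def)
    also have "\<dots> = ?R $$ (i, j)"
    proof -
      have c_less: "?c ! (j - p) < q" if "\<not> j < p"
        using that ij multi_indices_nth_less[OF c, of "j - p"] by simp
      have js_less: "js ! j < q" if "j < p"
        using that multi_indices_nth_less[OF js] by simp
      have "?R $$ (i, j) = (if i < p then if j < p then column_submatrix A js $$ (i, j) else 0
          else if j < p then 0 else column_submatrix B ?c $$ (i - p, j - p))"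
        using ij A B len by (subst index_mat_four_block(1)) (auto simp: column_submatrix_def)
      then show ?thesis
        using ij len c_less js_less
        by (auto simp: append_rows_index[OF A B] \<tau>_nth column_submatrix_index[OF A]
          column_submatrix_index[OF B])
    qed
    finally show "?L $$ (i, j) = ?R $$ (i, j)" .
  qed
  also have "det ?R = det (column_submatrix A js) * det (column_submatrix B ?c)"
  proof (rule det_four_block_mat_upper_right_zero)
    show "column_submatrix A js \<in> carrier_mat p p"
      using A len column_submatrix_carrier by metis
    show "column_submatrix B ?c \<in> carrier_mat (q - p) (q - p)"
      using B len column_submatrix_carrier by metis
  qed auto
  finally have "signof \<tau> * (signof \<tau> * det ?N) =
      signof \<tau> * (det (column_submatrix A js) * det (column_submatrix B ?c))"
    by simp
  moreover have "signof \<tau> * (signof \<tau> * det ?N) = det ?N"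
    by (simp add: sign_def)
  moreover have "ordering_sign (js @ ?c) = sign \<tau>"
    using ordering_sign_eq_sign[OF l(1,2)] by (simp add: l_def \<tau>_def)
  ultimately show ?thesis
    by (simp add: mult.assoc)
qed

text \<open>
  Every permutation maps the first \<open>p\<close> indices onto exactly one set of size \<open>p\<close>, so its Leibniz
  term survives in exactly one of the restricted matrices.
\<close>

lemma det_eq_sum_restrict_blocks:
  fixes M :: "'k::comm_ring_1 mat"
  assumes M: "M \<in> carrier_mat q q" and pq: "p \<le> q"
  shows "det M = (\<Sum>js\<in>multi_indices q p. det (restrict_blocks p (set js) M))"
proof -
  let ?N = "\<lambda>js. restrict_blocks p (set js) M"
  have term_sum: "(\<Sum>js\<in>multi_indices q p. \<Prod>i = 0..<q. ?N js $$ (i, \<sigma> i)) =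
      (\<Prod>i = 0..<q. M $$ (i, \<sigma> i))" if \<sigma>: "\<sigma> permutes {0..<q}" for \<sigma>
  proof -
    define ks where "ks = sorted_list_of_set (\<sigma> ` {..<p})"
    have inj: "inj \<sigma>"
      using \<sigma> by (rule permutes_inj)
    have less: "\<sigma> i < q" if "i < q" for i
      using that permutes_in_image[OF \<sigma>, of i] by simp
    have card: "card (\<sigma> ` {..<p}) = p"
      using inj by (simp add: card_image inj_on_subset)
    have "\<sigma> ` {..<p} \<subseteq> {..<q}"
      using less pq by fastforce
    then have ks: "ks \<in> multi_indices q p" "set ks = \<sigma> ` {..<p}"
      using sorted_list_of_set_multi_indices[of "\<sigma> ` {..<p}" q] card by (simp_all add: ks_def)
    have "(\<Prod>i = 0..<q. ?N js $$ (i, \<sigma> i)) = (if js = ks then \<Prod>i = 0..<q. M $$ (i, \<sigma> i) else 0)"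
      if js: "js \<in> multi_indices q p" for js
    proof (cases "js = ks")
      case True
      have "?N ks $$ (i, \<sigma> i) = M $$ (i, \<sigma> i)" if "i < q" for i
        using that less[OF that] M ks(2) inj
        by (auto simp: restrict_blocks_def dest: injD)
      then show ?thesis
        using True by simp
    next
      case False
      have "\<not> \<sigma> ` {..<p} \<subseteq> set js"
      proof
        assume "\<sigma> ` {..<p} \<subseteq> set js"
        moreover have "card (set js) = p"
          using js multi_indices_distinct[OF js] by (simp add: multi_indices_def distinct_card)
        ultimately have "\<sigma> ` {..<p} = set js"
          using card by (intro card_subset_eq) auto
        then show False
          using False multi_indices_eqI[OF js ks(1)] ks(2) by simp
      qed
      then obtain i where i: "i < p" "\<sigma> i \<notin> set js"
        by auto
      have "?N js $$ (i, \<sigma> i) = 0"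
        using i pq less[of i] M by (simp add: restrict_blocks_def)
      then have "\<exists>i\<in>{0..<q}. ?N js $$ (i, \<sigma> i) = 0"
        using i pq by (intro bexI[of _ i]) auto
      then have "(\<Prod>i = 0..<q. ?N js $$ (i, \<sigma> i)) = 0"
        by (intro prod_zero) auto
      then show ?thesis
        using False by simp
    qed
    then show ?thesis
      using ks(1) by (simp add: sum.delta' finite_multi_indices cong: sum.cong)
  qed
  have "det M = (\<Sum>\<sigma> | \<sigma> permutes {0..<q}.
      signof \<sigma> * (\<Sum>js\<in>multi_indices q p. \<Prod>i = 0..<q. ?N js $$ (i, \<sigma> i)))"
    unfolding det_def'[OF M] by (intro sum.cong refl) (simp only: term_sum mem_Collect_eq)
  also have "\<dots> = (\<Sum>\<sigma> | \<sigma> permutes {0..<q}. \<Sum>js\<in>multi_indices q p.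
      signof \<sigma> * (\<Prod>i = 0..<q. ?N js $$ (i, \<sigma> i)))"
    by (simp only: sum_distrib_left)
  also have "\<dots> = (\<Sum>js\<in>multi_indices q p. \<Sum>\<sigma> | \<sigma> permutes {0..<q}.
      signof \<sigma> * (\<Prod>i = 0..<q. ?N js $$ (i, \<sigma> i)))"
    by (rule sum.swap)
  also have "\<dots> = (\<Sum>js\<in>multi_indices q p. det (?N js))"
    by (simp only: det_def'[OF restrict_blocks_carrier[OF M]])
  finally show ?thesis .
qed

theorem laplace_expansion_rows:
  fixes A B :: "'k::idom mat"
  assumes A: "A \<in> carrier_mat p q" and B: "B \<in> carrier_mat (q - p) q" and pq: "p \<le> q"
  shows "det (A @\<^sub>r B) = (\<Sum>js\<in>multi_indices q p.
    of_int (ordering_sign (js @ complement_index q js)) * det (column_submatrix A js)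
      * det (column_submatrix B (complement_index q js)))"
proof -
  have "A @\<^sub>r B \<in> carrier_mat q q"
    using carrier_append_rows[OF A B] pq by simp
  from det_eq_sum_restrict_blocks[OF this pq] show ?thesis
    using det_restrict_blocks[OF A B pq] by simp
qed

section \<open>The Cauchy--Binet formula\<close>

text \<open>
  The range of an injective choice of \<open>r\<close> indices, listed in increasing order, is a multi-index;
  the permutation records the order in which the choice runs through it.
\<close>

lemma bij_betw_multi_indices_permutations:
  "bij_betw (\<lambda>(is, \<sigma>). restrict (\<lambda>k. is ! \<sigma> k) {0..<r})
    (multi_indices n r \<times> {\<sigma>. \<sigma> permutes {0..<r}})
    {f \<in> {0..<r} \<rightarrow>\<^sub>E {0..<n}. inj_on f {0..<r}}"
  (is "bij_betw ?h ?D ?F")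
proof (rule bij_betw_imageI)
  have less: "\<sigma> k < r" if "\<sigma> permutes {0..<r}" "k < r" for \<sigma> k
    using that permutes_in_image[of \<sigma> "{0..<r}" k] by simp
  have set_image: "?h (is, \<sigma>) ` {0..<r} = set is"
    if "is \<in> multi_indices n r" "\<sigma> permutes {0..<r}" for "is" \<sigma>
  proof -
    have "?h (is, \<sigma>) ` {0..<r} = (!) is ` \<sigma> ` {0..<r}"
      by (auto simp: image_image)
    also have "\<sigma> ` {0..<r} = {0..<length is}"
      using that by (simp add: permutes_image multi_indices_def)
    finally show ?thesis
      using nth_image[of "length is" "is"] by (simp add: atLeast0LessThan)
  qed
  show "inj_on ?h ?D"
  proof (rule inj_onI, clarify)
    fix "is" \<sigma> js \<tau>
    assume *: "is \<in> multi_indices n r" "\<sigma> permutes {0..<r}" "js \<in> multi_indices n r"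
      "\<tau> permutes {0..<r}"
      and eq: "restrict (\<lambda>k. is ! \<sigma> k) {0..<r} = restrict (\<lambda>k. js ! \<tau> k) {0..<r}"
    have [simp]: "is = js"
      using set_image[OF *(1,2)] set_image[OF *(3,4)] eq
      by (intro multi_indices_eqI[OF *(1,3)]) simp
    have "\<sigma> k = \<tau> k" for k
    proof (cases "k < r")
      case True
      then have "js ! \<sigma> k = js ! \<tau> k"
        using fun_cong[OF eq, of k] by simp
      then show ?thesis
        using * less[OF _ True] multi_indices_distinct[OF *(3)]
        by (simp add: nth_eq_iff_index_eq multi_indices_def)
    qed (use * in \<open>simp add: permutes_not_in\<close>)
    then show "is = js \<and> \<sigma> = \<tau>"
      by auto
  qed
  show "?h ` ?D = ?F"
  proof (intro equalityI subsetI)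
    fix f
    assume "f \<in> ?h ` ?D"
    then obtain "is" \<sigma> where *: "is \<in> multi_indices n r" "\<sigma> permutes {0..<r}"
      and f: "f = restrict (\<lambda>k. is ! \<sigma> k) {0..<r}"
      by auto
    have "inj_on f {0..<r}"
    proof (rule eq_card_imp_inj_on)
      have "f ` {0..<r} = set is"
        using set_image[OF *] f by simp
      then show "card (f ` {0..<r}) = card {0..<r}"
        using * multi_indices_distinct[OF *(1)] by (simp add: distinct_card multi_indices_def)
    qed simp
    moreover have "f \<in> {0..<r} \<rightarrow>\<^sub>E {0..<n}"
      using * less multi_indices_nth_less[OF *(1)] by (auto simp: f)
    ultimately show "f \<in> ?F"
      by simp
  next
    fix f
    assume "f \<in> ?F"
    then have f: "f \<in> {0..<r} \<rightarrow>\<^sub>E {0..<n}" and inj: "inj_on f {0..<r}"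
      by simp_all
    define "is" where "is = sorted_list_of_set (f ` {0..<r})"
    have "f ` {0..<r} \<subseteq> {..<n}"
      using f by fastforce
    then have "is": "is \<in> multi_indices n r" "set is = f ` {0..<r}"
      using sorted_list_of_set_multi_indices[of "f ` {0..<r}" n] card_image[OF inj]
      by (simp_all add: is_def)
    have len: "length is = r"
      using "is" by (simp add: multi_indices_def)
    have nth: "bij_betw ((!) is) {0..<r} (f ` {0..<r})"
      using "is" len multi_indices_distinct by (intro bij_betw_nth) auto
    define \<sigma> where "\<sigma> k = (if k < r then inv_into {0..<r} ((!) is) (f k) else k)" for k
    have "bij_betw (inv_into {0..<r} ((!) is) \<circ> f) {0..<r} {0..<r}"
      using inj nth by (blast intro: bij_betw_trans bij_betw_inv_into inj_on_imp_bij_betw)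
    then have "bij_betw \<sigma> {0..<r} {0..<r}"
      by (subst bij_betw_cong[where g = "inv_into {0..<r} ((!) is) \<circ> f"]) (auto simp: \<sigma>_def)
    then have \<sigma>: "\<sigma> permutes {0..<r}"
      by (rule bij_imp_permutes) (simp add: \<sigma>_def)
    have "is ! \<sigma> k = f k" if "k < r" for k
      using that bij_betw_inv_into_right[OF nth, of "f k"] by (simp add: \<sigma>_def)
    then have "f = ?h (is, \<sigma>)"
      using f by (auto simp: fun_eq_iff PiE_def extensional_def)
    then show "f \<in> ?h ` ?D"
      using "is"(1) \<sigma> by blast
  qed
qed

text \<open>
  Expanding the rows of the product gives one determinant for every choice of \<open>r\<close> rows of \<open>W\<close>.
  A choice with a repeated row contributes nothing, and the choices with the same set of rows
  add up to one minor of \<open>G\<close> times one minor of \<open>W\<close>.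
\<close>

theorem cauchy_binet:
  fixes G W :: "'k::comm_ring_1 mat"
  assumes G: "G \<in> carrier_mat r n" and W: "W \<in> carrier_mat n r"
  shows "det (G * W) =
    (\<Sum>is\<in>multi_indices n r. det (column_submatrix G is) * det (row_submatrix W is))"
proof -
  let ?P = "{\<sigma>. \<sigma> permutes {0..<r}}"
  let ?F = "{0..<r} \<rightarrow>\<^sub>E {0..<n}"
  let ?rows = "\<lambda>f. mat r r (\<lambda>(i, j). W $$ (f i, j))"
  let ?g = "\<lambda>f. (\<Prod>i = 0..<r. G $$ (i, f i)) * det (?rows f)"
  have GW: "G * W \<in> carrier_mat r r"
    using G W by simp
  have fin: "finite ?F"
    by (intro finite_PiE) auto
  have perm_less: "\<sigma> i < r" if "\<sigma> permutes {0..<r}" "i < r" for \<sigma> i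
    using that permutes_in_image[of \<sigma> "{0..<r}" i] by simp
  have entry: "(G * W) $$ (i, \<sigma> i) = (\<Sum>k = 0..<n. G $$ (i, k) * W $$ (k, \<sigma> i))"
    if "\<sigma> permutes {0..<r}" "i < r" for \<sigma> i
    using that perm_less[OF that] G W by (simp add: scalar_prod_def)
  have "det (G * W) = (\<Sum>\<sigma>\<in>?P. signof \<sigma> *
      (\<Prod>i = 0..<r. \<Sum>k = 0..<n. G $$ (i, k) * W $$ (k, \<sigma> i)))"
    unfolding det_def'[OF GW] by (intro sum.cong refl arg_cong2[where f = "(*)"] prod.cong)
      (auto simp: entry simp del: index_mult_mat)
  also have "\<dots> = (\<Sum>\<sigma>\<in>?P. \<Sum>f\<in>?F. signof \<sigma> * (\<Prod>i = 0..<r. G $$ (i, f i) * W $$ (f i, \<sigma> i)))"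
    by (simp add: prod_sum_PiE sum_distrib_left)
  also have "\<dots> = (\<Sum>f\<in>?F. \<Sum>\<sigma>\<in>?P. signof \<sigma> * (\<Prod>i = 0..<r. G $$ (i, f i) * W $$ (f i, \<sigma> i)))"
    by (rule sum.swap)
  also have "\<dots> = (\<Sum>f\<in>?F. ?g f)"
  proof (rule sum.cong[OF refl])
    fix f
    have "det (?rows f) = (\<Sum>\<sigma>\<in>?P. signof \<sigma> * (\<Prod>i = 0..<r. W $$ (f i, \<sigma> i)))"
      using perm_less by (subst det_def'[of _ r]) (auto intro!: sum.cong prod.cong)
    then show "(\<Sum>\<sigma>\<in>?P. signof \<sigma> * (\<Prod>i = 0..<r. G $$ (i, f i) * W $$ (f i, \<sigma> i))) = ?g f"
      by (simp add: prod.distrib sum_distrib_left mult_ac)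
  qed
  also have "\<dots> = (\<Sum>f\<in>{f \<in> ?F. inj_on f {0..<r}}. ?g f)"
  proof (rule sum.mono_neutral_right[OF fin])
    show "\<forall>f\<in>?F - {f \<in> ?F. inj_on f {0..<r}}. ?g f = 0"
    proof
      fix f
      assume "f \<in> ?F - {f \<in> ?F. inj_on f {0..<r}}"
      then obtain i j where "i < r" "j < r" "i \<noteq> j" "f i = f j"
        by (auto simp: inj_on_def)
      then have "det (?rows f) = 0"
        by (intro det_identical_rows[of _ r i j]) auto
      then show "?g f = 0"
        by simp
    qed
  qed auto
  also have "\<dots> = (\<Sum>(is, \<sigma>)\<in>multi_indices n r \<times> ?P. ?g (restrict (\<lambda>k. is ! \<sigma> k) {0..<r}))"
    by (subst sum.reindex_bij_betw[OF bij_betw_multi_indices_permutations, symmetric])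
      (simp add: case_prod_unfold)
  also have "\<dots> = (\<Sum>is\<in>multi_indices n r. \<Sum>\<sigma>\<in>?P. ?g (restrict (\<lambda>k. is ! \<sigma> k) {0..<r}))"
    by (simp add: sum.cartesian_product)
  also have "\<dots> = (\<Sum>is\<in>multi_indices n r. det (column_submatrix G is) * det (row_submatrix W is))"
  proof (rule sum.cong[OF refl])
    fix "is"
    assume "is": "is \<in> multi_indices n r"
    then have len: "length is = r"
      by (simp add: multi_indices_def)
    have C: "column_submatrix G is \<in> carrier_mat r r" and R: "row_submatrix W is \<in> carrier_mat r r"
      using G W len column_submatrix_carrier row_submatrix_carrier by metis+
    have "?g (restrict (\<lambda>k. is ! \<sigma> k) {0..<r}) =
        signof \<sigma> * (\<Prod>i = 0..<r. column_submatrix G is $$ (i, \<sigma> i)) * det (row_submatrix W is)"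
      if \<sigma>: "\<sigma> permutes {0..<r}" for \<sigma>
    proof -
      have less: "is ! \<sigma> i < n" "\<sigma> i < r" if "i < r" for i
        using perm_less[OF \<sigma> that] multi_indices_nth_less[OF "is"] by simp_all
      have "?rows (restrict (\<lambda>k. is ! \<sigma> k) {0..<r}) =
          mat r r (\<lambda>(i, j). row_submatrix W is $$ (\<sigma> i, j))"
        using len less by (intro eq_matI) (simp_all add: row_submatrix_index[OF W])
      then have "det (?rows (restrict (\<lambda>k. is ! \<sigma> k) {0..<r})) =
          signof \<sigma> * det (row_submatrix W is)"
        using det_permute_rows[OF R \<sigma>] by simp
      moreover have "(\<Prod>i = 0..<r. G $$ (i, restrict (\<lambda>k. is ! \<sigma> k) {0..<r} i)) =
          (\<Prod>i = 0..<r. column_submatrix G is $$ (i, \<sigma> i))"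
        using len less by (intro prod.cong) (simp_all add: column_submatrix_index[OF G])
      ultimately show ?thesis
        by (simp add: mult_ac)
    qed
    then show "(\<Sum>\<sigma>\<in>?P. ?g (restrict (\<lambda>k. is ! \<sigma> k) {0..<r})) =
        det (column_submatrix G is) * det (row_submatrix W is)"
      by (simp add: det_def'[OF C] sum_distrib_right)
  qed
  finally show ?thesis .
qed

section \<open>Gram matrices and coordinates\<close>

lemma gram_matrix_carrier [simp]: "gram_matrix ip vs ws \<in> carrier_mat (length vs) (length ws)"
  by (simp add: gram_matrix_def)

lemma gram_matrix_append:
  "gram_matrix ip (vs @ xs) ws = gram_matrix ip vs ws @\<^sub>r gram_matrix ip xs ws"
  by (rule eq_matI) (auto simp: gram_matrix_def append_rows_def nth_append)

lemma gram_matrix_select: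
  assumes "set js \<subseteq> {..<length ws}"
  shows "gram_matrix ip vs (select ws js) = column_submatrix (gram_matrix ip vs ws) js"
proof -
  have "js ! j < length ws" if "j < length js" for j
    using that assms nth_less_if_set_subset by metis
  then show ?thesis
    by (intro eq_matI)
      (auto simp: gram_matrix_def select_def column_submatrix_def mat_of_cols_index)
qed

lemma column_submatrix_mult:
  assumes "G \<in> carrier_mat a b" "W \<in> carrier_mat b c" "set js \<subseteq> {..<c}"
  shows "column_submatrix (G * W) js = G * column_submatrix W js"
proof -
  have less: "js ! j < c" if "j < length js" for j
    using that assms nth_less_if_set_subset by metis
  have "col (column_submatrix W js) j = col W (js ! j)" if "j < length js" for j
    using that assms less[OF that] by (auto simp: column_submatrix_def mat_of_cols_index)
  then show ?thesis
    using assms less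
    by (intro eq_matI) (auto simp: column_submatrix_def mat_of_cols_index)
qed

lemma row_column_submatrix_commute:
  assumes "W \<in> carrier_mat a b" "set is \<subseteq> {..<a}" "set js \<subseteq> {..<b}"
  shows "column_submatrix (row_submatrix W is) js = row_submatrix (column_submatrix W js) is"
proof -
  have "is ! i < a" if "i < length is" for i
    using that assms nth_less_if_set_subset by metis
  moreover have "js ! j < b" if "j < length js" for j
    using that assms nth_less_if_set_subset by metis
  ultimately show ?thesis
    using assms by (intro eq_matI)
      (auto simp: row_submatrix_def column_submatrix_def mat_of_rows_index mat_of_cols_index)
qed

lemma conj_zero [simp]: "conj (0::'k::real_or_complex) = 0"
  using conj_scaleR[of 0 "0::'k"] by simp

lemma conj_sum: "conj (sum f S) = (\<Sum>i\<in>S. conj (f i :: 'k::real_or_complex))"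
  by (induction S rule: infinite_finite_induct) (simp_all add: conj_add)

context inner_product_space
begin

lemma ip_zero_right [simp]: "ip x 0 = 0"
  using ip_scale_right[of x 0 0] by simp

lemma ip_minus_right: "ip x (y - z) = ip x y - ip x z"
  using ip_add_right[of x "y - z" z] by simp

lemma ip_sum_right: "ip x (sum f S) = (\<Sum>i\<in>S. ip x (f i))"
  by (induction S rule: infinite_finite_induct) (simp_all add: ip_add_right)

lemma ip_sum_left: "ip (sum f S) x = (\<Sum>i\<in>S. ip (f i) x)"
proof -
  have "ip (sum f S) x = conj (\<Sum>i\<in>S. ip x (f i))"
    by (subst ip_commute) (simp only: ip_sum_right)
  also have "\<dots> = (\<Sum>i\<in>S. conj (ip x (f i)))"
    by (rule conj_sum)
  finally show ?thesis
    by (simp add: ip_commute[symmetric])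
qed

lemma ip_scale_left: "ip (scale c x) y = conj c * ip x y"
  by (subst ip_commute) (simp only: ip_scale_right conj_mult ip_commute[symmetric])

lemma ip_eqI:
  assumes "\<And>z. ip z x = ip z y"
  shows "x = y"
proof (rule ccontr)
  assume "x \<noteq> y"
  then have "ip (x - y) (x - y) \<noteq> 0"
    using ip_pos[of "x - y"] by auto
  then show False
    using assms by (simp add: ip_minus_right)
qed

text \<open>
  The coordinates enter through the right argument, in which \<open>ip\<close> is linear, so the coordinate
  matrix appears without conjugation.
\<close>

lemma gram_matrix_coordinates:
  assumes "is_basis scale us"
  shows "gram_matrix ip xs ws = gram_matrix ip xs us * coordinate_matrix scale us ws"
proof (rule eq_matI)
  fix i j
  assume "i < dim_row (gram_matrix ip xs us * coordinate_matrix scale us ws)"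
    and "j < dim_col (gram_matrix ip xs us * coordinate_matrix scale us ws)"
  then have ij: "i < length xs" "j < length ws"
    by (simp_all add: gram_matrix_def coordinate_matrix_def)
  let ?rep = "representation (set us) (ws ! j)"
  have us: "distinct us" "independent (set us)" "span (set us) = UNIV"
    using assms by (simp_all add: is_basis_def)
  have "ws ! j = (\<Sum>u\<in>set us. scale (?rep u) u)"
    using us by (intro sum_representation_eq[symmetric]) auto
  also have "\<dots> = (\<Sum>k<length us. scale (?rep (us ! k)) (us ! k))"
    by (rule sum.reindex_bij_betw[symmetric], rule bij_betw_nth) (use us in auto)
  finally have "ip (xs ! i) (ws ! j) = ip (xs ! i) (\<Sum>k<length us. scale (?rep (us ! k)) (us ! k))"
    by (rule arg_cong)
  also have "\<dots> = (\<Sum>k<length us. ip (xs ! i) (us ! k) * ?rep (us ! k))"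
    by (simp add: ip_sum_right ip_scale_right mult.commute)
  finally show "gram_matrix ip xs ws $$ (i, j) =
      (gram_matrix ip xs us * coordinate_matrix scale us ws) $$ (i, j)"
    using ij by (simp add: gram_matrix_def coordinate_matrix_def scalar_prod_def atLeast0LessThan)
qed (simp_all add: gram_matrix_def coordinate_matrix_def)

end

section \<open>The left contraction\<close>

lemma wedge_list_append: "wedge_list \<iota> (vs @ xs) = wedge_list \<iota> vs * wedge_list \<iota> xs"
  by (simp add: wedge_list_def)

context inner_exterior_algebra
begin

text \<open>
  Products of vectors span the exterior algebra, so they suffice as test elements; the inner
  product is definite, so the tests determine the contraction.
\<close>

lemma left_contraction_eqI:
  assumes test: "\<And>xs. ipE (wedge_list \<iota> xs) C = ipE (M * wedge_list \<iota> xs) N"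
  shows "left_contraction ipE M N = C"
proof -
  have C: "ipE L C = ipE (M * L) N" for L
  proof -
    obtain y where y: "L = free_algebra_map scaleE \<iota> y"
      using surj_free_algebra_map by (blast elim: surjE)
    have "M * L = (\<Sum>xs\<in>Poly_Mapping.keys y.
        scaleE (Poly_Mapping.lookup y xs) (M * wedge_list \<iota> xs))"
      by (simp add: y free_algebra_map_def sum_distrib_left scaleE_mult_right)
    then show ?thesis
      by (simp add: y free_algebra_map_def E.ip_sum_left E.ip_scale_left test)
  qed
  show ?thesis
    unfolding left_contraction_def
  proof (rule the_equality)
    fix D
    assume "\<forall>L. ipE L D = ipE (M * L) N"
    then show "D = C"
      using C by (intro E.ip_eqI) simp
  qed (use C in blast)
qed

text \<open>
  By orthogonality of the degrees, only test products of \<open>length ws - length vs\<close> vectors matter,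
  and for these the two sides are determinants.
\<close>

lemma left_contraction_wedge_eqI:
  assumes le: "length vs \<le> length ws"
    and len: "\<And>i. i \<in> I \<Longrightarrow> length (t i) = length ws - length vs"
    and det: "\<And>xs. length xs = length ws - length vs \<Longrightarrow>
      det (gram_matrix ip vs ws @\<^sub>r gram_matrix ip xs ws) = (\<Sum>i\<in>I. c i * det (gram_matrix ip xs (t i)))"
  shows "left_contraction ipE (wedge_list \<iota> vs) (wedge_list \<iota> ws) =
    (\<Sum>i\<in>I. scaleE (c i) (wedge_list \<iota> (t i)))"
proof (rule left_contraction_eqI)
  fix xs
  show "ipE (wedge_list \<iota> xs) (\<Sum>i\<in>I. scaleE (c i) (wedge_list \<iota> (t i))) =
      ipE (wedge_list \<iota> vs * wedge_list \<iota> xs) (wedge_list \<iota> ws)"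
  proof (cases "length xs = length ws - length vs")
    case True
    then have "length (vs @ xs) = length ws"
      using le by simp
    then have "ipE (wedge_list \<iota> vs * wedge_list \<iota> xs) (wedge_list \<iota> ws) =
        det (gram_matrix ip vs ws @\<^sub>r gram_matrix ip xs ws)"
      by (simp only: wedge_list_append[symmetric] ipE_wedge_list gram_matrix_append)
    with True show ?thesis
      by (simp add: E.ip_sum_right E.ip_scale_right ipE_wedge_list len det)
  next
    case False
    then have "length (vs @ xs) \<noteq> length ws"
      using le by simp
    then have "ipE (wedge_list \<iota> vs * wedge_list \<iota> xs) (wedge_list \<iota> ws) = 0"
      unfolding wedge_list_append[symmetric] by (rule ipE_orthogonal)
    with False show ?thesis
      by (simp add: E.ip_sum_right E.ip_scale_right ipE_orthogonal len)
  qed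
qed

end

text \<open>
  Laplace expansion on both sides reduces the claim to the Cauchy--Binet formula for \<open>G\<close> and the
  complementary columns of \<open>W\<close>.
\<close>

lemma det_append_mult_rows:
  fixes A G W :: "'k::idom mat"
  assumes A: "A \<in> carrier_mat p q" and G: "G \<in> carrier_mat (q - p) n" and W: "W \<in> carrier_mat n q"
    and pq: "p \<le> q"
  shows "det (A @\<^sub>r (G * W)) =
    (\<Sum>is\<in>multi_indices n (q - p). det (A @\<^sub>r row_submatrix W is) * det (column_submatrix G is))"
proof -
  let ?I = "multi_indices n (q - p)" and ?c = "complement_index q"
  let ?a = "\<lambda>js. of_int (ordering_sign (js @ ?c js)) * det (column_submatrix A js)"
  have "det (A @\<^sub>r (G * W)) =
      (\<Sum>js\<in>multi_indices q p. ?a js * det (column_submatrix (G * W) (?c js)))"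
    using G W by (intro laplace_expansion_rows[OF A _ pq]) auto
  also have "\<dots> = (\<Sum>js\<in>multi_indices q p. \<Sum>is\<in>?I.
      ?a js * det (column_submatrix (row_submatrix W is) (?c js)) * det (column_submatrix G is))"
  proof (rule sum.cong[OF refl])
    fix js
    assume "js \<in> multi_indices q p"
    then have c: "set (?c js) \<subseteq> {..<q}" "length (?c js) = q - p"
      using complement_index_multi_indices[of js q p] by (simp_all add: multi_indices_def)
    have "column_submatrix W (?c js) \<in> carrier_mat n (q - p)"
      using W c(2) column_submatrix_carrier by metis
    then have "det (column_submatrix (G * W) (?c js)) = (\<Sum>is\<in>?I.
        det (column_submatrix G is) * det (row_submatrix (column_submatrix W (?c js)) is))"
      using cauchy_binet[OF G] column_submatrix_mult[OF G W c(1)] by simp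
    also have "\<dots> = (\<Sum>is\<in>?I.
        det (column_submatrix (row_submatrix W is) (?c js)) * det (column_submatrix G is))"
    proof (rule sum.cong[OF refl])
      fix "is"
      assume "is \<in> ?I"
      then show "det (column_submatrix G is) * det (row_submatrix (column_submatrix W (?c js)) is) =
          det (column_submatrix (row_submatrix W is) (?c js)) * det (column_submatrix G is)"
        using row_column_submatrix_commute[OF W _ c(1), of "is"] by (simp add: multi_indices_def)
    qed
    finally show "?a js * det (column_submatrix (G * W) (?c js)) = (\<Sum>is\<in>?I.
        ?a js * det (column_submatrix (row_submatrix W is) (?c js)) * det (column_submatrix G is))"
      by (simp add: sum_distrib_left mult.assoc)
  qed
  also have "\<dots> = (\<Sum>is\<in>?I. \<Sum>js\<in>multi_indices q p.
      ?a js * det (column_submatrix (row_submatrix W is) (?c js)) * det (column_submatrix G is))"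
    by (rule sum.swap)
  also have "\<dots> = (\<Sum>is\<in>?I. det (A @\<^sub>r row_submatrix W is) * det (column_submatrix G is))"
  proof (rule sum.cong[OF refl])
    fix "is"
    assume "is \<in> ?I"
    then have "row_submatrix W is \<in> carrier_mat (q - p) q"
      using W row_submatrix_carrier[OF W, of "is"] by (simp add: multi_indices_def)
    then show "(\<Sum>js\<in>multi_indices q p.
        ?a js * det (column_submatrix (row_submatrix W is) (?c js)) * det (column_submatrix G is)) =
        det (A @\<^sub>r row_submatrix W is) * det (column_submatrix G is)"
      by (simp add: laplace_expansion_rows[OF A _ pq] sum_distrib_right)
  qed
  finally show ?thesis .
qed

theorem proposition3p41:
  fixes scale :: "'k::real_or_complex \<Rightarrow> 'a::ab_group_add \<Rightarrow> 'a"
    and ip :: "'a \<Rightarrow> 'a \<Rightarrow> 'k"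
    and scaleE :: "'k \<Rightarrow> 'e::ring_1 \<Rightarrow> 'e"
    and \<iota> :: "'a \<Rightarrow> 'e"
    and ipE :: "'e \<Rightarrow> 'e \<Rightarrow> 'k"
    and n p q :: nat
    and vs ws us :: "'a list"
    and A B :: 'e
    and AA W :: "'k mat"
  assumes "inner_exterior_algebra n scale ip scaleE \<iota> ipE"
    and "length vs = p" and "A = wedge_list \<iota> vs"
    and "length ws = q" and "B = wedge_list \<iota> ws"
    and "AA = gram_matrix ip vs ws"
    and "length us = n" and "is_basis scale us"
    and "W = coordinate_matrix scale us ws"
    and "p \<le> q"
  shows "left_contraction ipE A B =
      (\<Sum>js\<in>multi_indices q p.
        scaleE (of_int (ordering_sign (js @ complement_index q js)) * det (column_submatrix AA js))
          (wedge_list \<iota> (select ws (complement_index q js))))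
    \<and> left_contraction ipE A B =
      (\<Sum>is\<in>multi_indices n (q - p).
        scaleE (det (AA @\<^sub>r row_submatrix W is)) (wedge_list \<iota> (select us is)))"
proof -
  interpret inner_exterior_algebra n scale ip scaleE \<iota> ipE
    by fact
  have AA: "AA \<in> carrier_mat p q"
    using assms(2,4,6) by (auto simp: gram_matrix_def)
  have W: "W \<in> carrier_mat n q"
    using assms(4,7,9) by (auto simp: coordinate_matrix_def)
  have le: "length vs \<le> length ws"
    using assms(2,4) \<open>p \<le> q\<close> by simp
  have gram: "gram_matrix ip xs ys \<in> carrier_mat (q - p) (length ys)"
    if "length xs = length ws - length vs" for xs ys
    using gram_matrix_carrier[of ip xs ys] that assms(2,4) by simp
  show ?thesis
    unfolding \<open>A = _\<close> \<open>B = _\<close>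
  proof (intro conjI left_contraction_wedge_eqI[OF le])
    fix js
    assume "js \<in> multi_indices q p"
    then show "length (select ws (complement_index q js)) = length ws - length vs"
      using complement_index_multi_indices[of js q p] assms(2,4)
      by (simp add: select_def multi_indices_def)
  next
    fix xs :: "'a list"
    assume "length xs = length ws - length vs"
    note H = gram[OF this, of ws]
    have select: "gram_matrix ip xs (select ws (complement_index q js)) =
        column_submatrix (gram_matrix ip xs ws) (complement_index q js)" for js
      using assms(4) by (intro gram_matrix_select) (auto simp: set_complement_index)
    show "det (gram_matrix ip vs ws @\<^sub>r gram_matrix ip xs ws) = (\<Sum>js\<in>multi_indices q p.
        of_int (ordering_sign (js @ complement_index q js)) * det (column_submatrix AA js)
          * det (gram_matrix ip xs (select ws (complement_index q js))))"
      unfolding select assms(6)[symmetric]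
      using H assms(4) by (intro laplace_expansion_rows[OF AA _ \<open>p \<le> q\<close>]) simp
  next
    fix "is"
    assume "is \<in> multi_indices n (q - p)"
    then show "length (select us is) = length ws - length vs"
      using assms(2,4) by (simp add: select_def multi_indices_def)
  next
    fix xs :: "'a list"
    assume "length xs = length ws - length vs"
    note G = gram[OF this, of us]
    have "gram_matrix ip xs ws = gram_matrix ip xs us * W"
      unfolding assms(9) by (rule X.gram_matrix_coordinates[OF \<open>is_basis scale us\<close>])
    then have "det (gram_matrix ip vs ws @\<^sub>r gram_matrix ip xs ws) =
        (\<Sum>is\<in>multi_indices n (q - p).
          det (AA @\<^sub>r row_submatrix W is) * det (column_submatrix (gram_matrix ip xs us) is))"
      using det_append_mult_rows[OF AA _ W \<open>p \<le> q\<close>] G assms(6,7) by simp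
    also have "\<dots> = (\<Sum>is\<in>multi_indices n (q - p).
        det (AA @\<^sub>r row_submatrix W is) * det (gram_matrix ip xs (select us is)))"
      using assms(7) by (intro sum.cong refl) (simp add: gram_matrix_select multi_indices_def)
    finally show "det (gram_matrix ip vs ws @\<^sub>r gram_matrix ip xs ws) =
        (\<Sum>is\<in>multi_indices n (q - p).
          det (AA @\<^sub>r row_submatrix W is) * det (gram_matrix ip xs (select us is)))" .
  qed
qed

end
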